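(* Let $X$ be a real vector space, let $C, D \subseteq X$ be convex sets, let $F$ be a non-empty face of the convex set $C - D := \{c-d \mid c \in C, d \in D\}$, and let $P \subseteq X$ be a (compatible) preorder for which $F = \min_P (C-D)$. Then $F_C := \min_P(C)$ and $F_D := \max_P(D)$ are faces of $C$ and $D$ respectively, and $F = F_C - F_D$. Further, such a preorder $P$ always exists: for instance, $P := \operatorname{cone}((C-D)-F)$ is a preorder with $F = \min_P(C-D)$.
   Context: Vector spaces are real, of arbitrary (possibly infinite) dimension, with no topology. A convex cone contains the origin and is closed under addition and under multiplication by positive scalars; it is pointed if $K \cap (-K) = \{0\}$. A (compatible) preorder on $X$ is identified with its positive cone, a convex cone $P \subseteq X$, via $x \le_P y \iff y - x \in P$. For a set $S \subseteq X$, $\min_P S := \{s \in S \mid s \le_P s' \text{ for all } s' \in S\}$ and $\max_P S := \{s \in S \mid s' \le_P s \text{ for all } s' \in S\}$. $\operatorname{cone}(S) := \{\lambda s \mid \lambda \ge 0, s \in S\}$. An oriented affine map $f: X \to (Y, Y_+)$ is an affine map from $X$ to a real vector space $Y$ equipped with a pointed convex cone $Y_+ \subseteq Y$; it is positive on $S \subseteq X$ if $f(S) \subseteq Y_+$; $\ker f := f^{-1}(0)$. A face of a convex set $C \subseteq X$ is a set of the form $C \cap \ker f$ for some oriented affine map $f$ on $X$ that is positive on $C$. *)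

theory Defs
  imports "HOL-Analysis.Analysis"
begin

text \<open>
  The minus sign on sets is set difference, so the Minkowski difference gets its own symbol.
\<close>

definition minkowski_diff :: "'a::real_vector set \<Rightarrow> 'a set \<Rightarrow> 'a set"  (infixl \<open>\<ominus>\<close> 65)
  where "A \<ominus> B = {a - b | a b. a \<in> A \<and> b \<in> B}"

text \<open>
  A compatible preorder is given by its positive cone \<open>P\<close>, a \<^const>\<open>convex_cone\<close>; it need not
  be pointed.
\<close>

definition cone_le :: "'a::real_vector set \<Rightarrow> 'a \<Rightarrow> 'a \<Rightarrow> bool"
  where "cone_le P x y \<longleftrightarrow> y - x \<in> P"

definition min_set :: "'a::real_vector set \<Rightarrow> 'a set \<Rightarrow> 'a set"
  where "min_set P S = {s \<in> S. \<forall>s'\<in>S. cone_le P s s'}"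

definition max_set :: "'a::real_vector set \<Rightarrow> 'a set \<Rightarrow> 'a set"
  where "max_set P S = {s \<in> S. \<forall>s'\<in>S. cone_le P s' s}"

lemma convex_cone_iff_positive_scaling:
  "convex_cone K \<longleftrightarrow>
     0 \<in> K \<and> (\<forall>x\<in>K. \<forall>y\<in>K. x + y \<in> K) \<and> (\<forall>x\<in>K. \<forall>c>0. c *\<^sub>R x \<in> K)"
  unfolding convex_cone_iff
proof (intro iffI; elim conjE; intro conjI ballI allI impI)
  fix x and c :: real
  assume "0 \<in> K" and pos: "\<forall>x\<in>K. \<forall>c>0. c *\<^sub>R x \<in> K" and "x \<in> K" "0 \<le> c"
  then show "c *\<^sub>R x \<in> K"
    by (cases "c = 0") auto
qed auto

definition pointed :: "'a::real_vector set \<Rightarrow> bool"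
  where "pointed K \<longleftrightarrow> K \<inter> uminus ` K = {0}"

definition affine_map :: "('a::real_vector \<Rightarrow> 'b::real_vector) \<Rightarrow> bool"
  where "affine_map f \<longleftrightarrow> (\<exists>L b. linear L \<and> f = (\<lambda>x. L x + b))"

definition oriented_affine_map :: "('a::real_vector \<Rightarrow> 'b::real_vector) \<Rightarrow> 'b set \<Rightarrow> bool"
  where "oriented_affine_map f K \<longleftrightarrow> affine_map f \<and> convex_cone K \<and> pointed K"

text \<open>
  The target space of the oriented affine map cannot be quantified over inside a formula, so it
  is a type parameter. This is not the library's \<^const>\<open>face_of\<close>, which is the notion of an
  extreme subset.
\<close>

definition face_via :: "'b::real_vector itself \<Rightarrow> 'a::real_vector set \<Rightarrow> 'a set \<Rightarrow> bool"
  where "face_via TYPE('b) F C \<longleftrightarrow>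
    (\<exists>(f :: 'a \<Rightarrow> 'b) K. oriented_affine_map f K \<and> f ` C \<subseteq> K \<and> F = C \<inter> f -` {0})"

text \<open>
  The target \<open>'a \<times> real\<close> realises every face: the span of the image of an affine map on \<open>'a\<close> is
  a linear image of \<open>'a \<times> real\<close>, hence embeds in it. The summand \<open>real\<close> is needed only
  for the empty face of a zero-dimensional space.
\<close>

lemma face_via_universal:
  fixes F C :: "'a::real_vector set"
  assumes "face_via TYPE('b::real_vector) F C"
  shows "face_via TYPE('a \<times> real) F C"
proof -
  obtain f :: "'a \<Rightarrow> 'b" and K where f: "oriented_affine_map f K" "f ` C \<subseteq> K" "F = C \<inter> f -` {0}"
    using assms unfolding face_via_def by blast
  obtain L b where L: "linear L" and fL: "f = (\<lambda>x. L x + b)"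
    using f(1) unfolding oriented_affine_map_def affine_map_def by blast
  have K: "convex_cone K" "pointed K"
    using f(1) unfolding oriented_affine_map_def by auto
  define M :: "'a \<times> real \<Rightarrow> 'b" where "M = (\<lambda>p. L (fst p) + snd p *\<^sub>R b)"
  have M: "linear M"
    unfolding M_def using L
    by (intro linearI) (auto simp: linear_add linear_scale algebra_simps)
  obtain g where g: "linear g" and Mg: "\<And>v. v \<in> range M \<Longrightarrow> M (g v) = v"
    using linear_exists_right_inverse_on[OF M subspace_UNIV] by blast
  have f_range: "f x \<in> range M" for x
    by (rule range_eqI[of _ _ "(x, 1)"]) (simp add: M_def fL)
  define K' where "K' = g ` (K \<inter> range M)"
  have R: "subspace (range M)"
    using M by (simp add: linear_subspace_image)
  have "convex_cone (K \<inter> range M)"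
    using K(1) R unfolding convex_cone_iff subspace_def by auto
  then have "convex_cone K'"
    unfolding K'_def using g convex_cone_linear_image by blast
  moreover have "pointed K'"
    unfolding pointed_def
  proof (intro equalityI subsetI)
    fix y assume "y \<in> K' \<inter> uminus ` K'"
    then obtain u v where uv: "u \<in> K" "u \<in> range M" "v \<in> K" "v \<in> range M" "y = g u" "y = - g v"
      unfolding K'_def by auto
    have "u = M (g u)"
      by (rule Mg[OF uv(2), symmetric])
    also have "g u = - g v"
      using uv(5,6) by simp
    also have "M (- g v) = - v"
      by (simp only: linear_neg[OF M] Mg[OF uv(4)])
    finally have "u = - v" .
    then have "u \<in> K \<inter> uminus ` K"
      using uv by auto
    then have "u = 0"
      using K(2) unfolding pointed_def by blast
    then show "y \<in> {0}"
      using uv(5) linear_0[OF g] by simp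
  next
    fix y :: "'a \<times> real" assume "y \<in> {0}"
    moreover have "0 \<in> K'"
      using \<open>convex_cone K'\<close> by (rule convex_cone_contains_0)
    ultimately show "y \<in> K' \<inter> uminus ` K'"
      by (auto intro: image_eqI[of _ _ 0])
  qed
  moreover have "affine_map (g \<circ> f)"
    unfolding affine_map_def
    by (rule exI[of _ "g \<circ> L"], rule exI[of _ "g b"])
       (auto simp: fL fun_eq_iff linear_add[OF g] intro: linear_compose[OF L g])
  moreover have "(g \<circ> f) ` C \<subseteq> K'"
    unfolding K'_def using f(2) f_range by auto
  moreover have "F = C \<inter> (g \<circ> f) -` {0}"
  proof -
    have "g (f x) = 0 \<longleftrightarrow> f x = 0" for x
    proof
      assume "g (f x) = 0"
      then have "M (g (f x)) = 0"
        by (simp only: linear_0[OF M])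
      then show "f x = 0"
        by (simp only: Mg[OF f_range])
    qed (simp add: linear_0[OF g])
    then show ?thesis
      unfolding f(3) by (simp add: set_eq_iff)
  qed
  ultimately show ?thesis
    unfolding face_via_def oriented_affine_map_def by blast
qed

end

theory Submission
  imports Defs
begin

text \<open>
  The lineality space \<open>L = P \<inter> -P\<close> of a preorder has a linear complement, and projecting along
  \<open>L\<close> turns \<open>P\<close> into a pointed cone. Hence, for any least element \<open>c\<close> of \<open>C\<close>, the map
  \<open>x \<mapsto> pr (x - c)\<close> exhibits the set of least elements as a face.
  Conversely, if \<open>f\<close> is positive on \<open>E\<close> with zero set \<open>F\<close>, then \<open>s\<^sub>0 - s = t (e - s\<^sub>1)\<close> with
  \<open>s\<^sub>0, s\<^sub>1 \<in> F\<close> forces \<open>- f s = t f e\<close>, so pointedness gives \<open>f s = 0\<close>.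
\<close>

lemma minkowski_diff_iff: "x \<in> A \<ominus> B \<longleftrightarrow> (\<exists>a\<in>A. \<exists>b\<in>B. x = a - b)"
  unfolding minkowski_diff_def by blast

lemma convex_minkowski_diff:
  assumes "convex A" and "convex B"
  shows "convex (A \<ominus> B)"
proof -
  have "A \<ominus> B = (\<Union>a\<in>A. \<Union>b\<in>B. {a - b})"
    unfolding minkowski_diff_def by blast
  then show ?thesis
    using convex_differences[OF assms] by simp
qed

lemma convex_cone_uminus:
  fixes P :: "'a::real_vector set"
  assumes "convex_cone P"
  shows "convex_cone (uminus ` P)"
  by (rule convex_cone_linear_image[OF conjI[OF assms linear_uminus]])

text \<open>Reversing a preorder negates its cone, so results on least elements, applied to the
  opposite cone, also cover greatest elements.\<close>

lemma max_set_eq_min_set_uminus: "max_set P S = min_set (uminus ` P) S"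
proof -
  have "x - y \<in> uminus ` P \<longleftrightarrow> y - x \<in> P" for x y
    using inj_image_mem_iff[OF inj_uminus, of "y - x" P] by (simp only: minus_diff_eq)
  then show ?thesis
    by (simp only: max_set_def min_set_def cone_le_def)
qed

text \<open>\<open>P\<close> may fail to be pointed and then cannot be the target cone of an
  oriented affine map; its image under \<open>pr\<close> takes over that role.\<close>

lemma convex_cone_lineality_projection:
  fixes P :: "'a::real_vector set"
  assumes P: "convex_cone P"
  obtains pr :: "'a \<Rightarrow> 'a" where "linear pr" "\<And>x. pr x = 0 \<longleftrightarrow> x \<in> P \<and> - x \<in> P"
    "convex_cone (pr ` P)" "pointed (pr ` P)"
proof -
  define L where "L = {x. x \<in> P \<and> - x \<in> P}"
  have P0: "0 \<in> P" and Padd: "\<And>x y. x \<in> P \<Longrightarrow> y \<in> P \<Longrightarrow> x + y \<in> P"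
    and Psc: "\<And>x c. x \<in> P \<Longrightarrow> c \<ge> 0 \<Longrightarrow> c *\<^sub>R x \<in> P"
    using P unfolding convex_cone_iff by auto
  have L: "subspace L"
    unfolding subspace_def
  proof (intro conjI ballI allI)
    show "0 \<in> L" using P0 by (simp add: L_def)
  next
    fix x y assume "x \<in> L" "y \<in> L"
    then show "x + y \<in> L"
      using Padd[of x y] Padd[of "- x" "- y"] by (simp add: L_def)
  next
    fix c x assume "x \<in> L"
    then show "c *\<^sub>R x \<in> L"
      using Psc[of x c] Psc[of "- x" c] Psc[of x "- c"] Psc[of "- x" "- c"]
      by (cases "c \<ge> 0") (simp_all add: L_def)
  qed
  \<comment> \<open>A left inverse of the identity on \<open>L\<close> is a linear projection of the
    whole space onto \<open>L\<close>; subtracting it from the identity gives a map with kernel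
    exactly \<open>L\<close>.\<close>
  obtain g :: "'a \<Rightarrow> 'a" where g: "range g \<subseteq> L" "linear g" "\<And>x. x \<in> L \<Longrightarrow> g x = x"
    using linear_exists_left_inverse_on[OF linear_id L inj_on_id] by auto
  define pr where "pr = (\<lambda>x. x - g x)"
  have lin: "linear pr"
    unfolding pr_def using g(2) by (intro linear_compose_sub) (simp_all add: linear_ident)
  have pr0: "pr x = 0 \<longleftrightarrow> x \<in> P \<and> - x \<in> P" for x
  proof -
    have "pr x = 0 \<longleftrightarrow> x \<in> L"
      unfolding pr_def using g(1) g(3)[of x] by (metis eq_iff_diff_eq_0 rangeI subsetD)
    then show ?thesis by (simp add: L_def)
  qed
  have cone: "convex_cone (pr ` P)"
    using P lin by (simp add: convex_cone_linear_image)
  \<comment> \<open>Pointedness of the image: \<open>u + v\<close> lies in the kernel, hence in the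
    lineality space, and \<open>- u = v + (- (u + v))\<close> is then a sum of two elements of
    \<open>P\<close>.\<close>
  have "pr u = 0" if "u \<in> P" "v \<in> P" "pr u = - pr v" for u v
  proof -
    have "pr (u + v) = 0"
      using that(3) by (simp add: linear_add[OF lin])
    then have "- (u + v) \<in> P"
      using pr0 by blast
    then have "- u \<in> P"
      using Padd[OF that(2), of "- (u + v)"] by simp
    then show ?thesis
      using that(1) pr0 by blast
  qed
  moreover have "0 \<in> pr ` P"
    using cone by (rule convex_cone_contains_0)
  ultimately have "pointed (pr ` P)"
    unfolding pointed_def by (intro equalityI subsetI) (auto intro: image_eqI[of _ _ 0])
  with lin pr0 cone show thesis
    by (rule that)
qed

lemma face_via_min_set:
  fixes P C :: "'a::real_vector set"
  assumes P: "convex_cone P" and ne: "min_set P C \<noteq> {}"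
  shows "face_via TYPE('a) (min_set P C) C"
proof -
  obtain c where c: "c \<in> C" "\<And>x. x \<in> C \<Longrightarrow> x - c \<in> P"
    using ne unfolding min_set_def cone_le_def by blast
  obtain pr :: "'a \<Rightarrow> 'a" where pr: "linear pr" "\<And>x. pr x = 0 \<longleftrightarrow> x \<in> P \<and> - x \<in> P"
    "convex_cone (pr ` P)" "pointed (pr ` P)"
    by (rule convex_cone_lineality_projection[OF P]) blast
  define f where "f = (\<lambda>x. pr x + - pr c)"
  have f: "f x = pr (x - c)" for x
    by (simp add: f_def linear_diff[OF pr(1)])
  have "oriented_affine_map f (pr ` P)"
    unfolding oriented_affine_map_def affine_map_def using pr f_def by blast
  moreover have "f ` C \<subseteq> pr ` P"
    using c(2) by (auto simp: f)
  moreover have "min_set P C = C \<inter> f -` {0}"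
  proof (intro equalityI subsetI)
    fix x assume "x \<in> min_set P C"
    then have "x \<in> C" "c - x \<in> P"
      using c(1) unfolding min_set_def cone_le_def by auto
    then show "x \<in> C \<inter> f -` {0}"
      using c(2) by (simp add: f pr(2))
  next
    fix x assume x: "x \<in> C \<inter> f -` {0}"
    then have "c - x \<in> P"
      by (simp add: f pr(2))
    \<comment> \<open>An element equivalent to the least element \<open>c\<close> is itself least,
      by transitivity: \<open>y - x = (y - c) + (c - x)\<close>.\<close>
    then have "y - x \<in> P" if "y \<in> C" for y
      using convex_cone_add[OF P c(2)[OF that]] by fastforce
    with x show "x \<in> min_set P C"
      unfolding min_set_def cone_le_def by simp
  qed
  ultimately show ?thesis
    unfolding face_via_def by blast
qed

text \<open>The two variables of a difference can be compared independently: holding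
  \<open>d\<close> fixed shows that \<open>c\<close> is least in \<open>C\<close>, holding
  \<open>c\<close> fixed shows that \<open>d\<close> is greatest in \<open>D\<close>, and adding the
  two comparisons gives the converse.\<close>

lemma min_set_minkowski_diff:
  assumes P: "convex_cone P" and ne: "min_set P (C \<ominus> D) \<noteq> {}"
  shows "min_set P (C \<ominus> D) = min_set P C \<ominus> max_set P D"
proof (intro equalityI subsetI)
  fix x assume x: "x \<in> min_set P (C \<ominus> D)"
  then obtain c d where cd: "c \<in> C" "d \<in> D" "x = c - d"
    unfolding min_set_def minkowski_diff_iff by blast
  have le: "(c' - d') - (c - d) \<in> P" if "c' \<in> C" "d' \<in> D" for c' d'
  proof -
    have "c' - d' \<in> C \<ominus> D"
      using that minkowski_diff_iff by blast
    then show ?thesis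
      using x unfolding min_set_def cone_le_def cd(3) by blast
  qed
  have "c \<in> min_set P C"
    using cd(1) le[OF _ cd(2)] unfolding min_set_def cone_le_def by simp
  moreover have "d \<in> max_set P D"
    using cd(2) le[OF cd(1)] unfolding max_set_def cone_le_def by simp
  ultimately show "x \<in> min_set P C \<ominus> max_set P D"
    using cd(3) minkowski_diff_iff by blast
next
  fix x assume "x \<in> min_set P C \<ominus> max_set P D"
  then obtain c d where cd: "c \<in> C" "d \<in> D" "x = c - d"
    and c: "\<And>c'. c' \<in> C \<Longrightarrow> c' - c \<in> P" and d: "\<And>d'. d' \<in> D \<Longrightarrow> d - d' \<in> P"
    unfolding min_set_def max_set_def cone_le_def minkowski_diff_iff by blast
  have "(c' - d') - x \<in> P" if "c' \<in> C" "d' \<in> D" for c' d'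
  proof -
    have "(c' - c) + (d - d') \<in> P"
      using P c[OF that(1)] d[OF that(2)] unfolding convex_cone_iff by blast
    then show ?thesis
      by (simp add: cd(3) algebra_simps)
  qed
  then show "x \<in> min_set P (C \<ominus> D)"
    using cd by (auto simp: min_set_def cone_le_def minkowski_diff_iff)
qed

text \<open>The zero set of an affine map is the preimage of a point under its linear part. This
  serves to make \<open>E \<ominus> F\<close> convex, so that its cone hull is a convex
  cone.\<close>

lemma convex_face_via:
  fixes F E :: "'a::real_vector set"
  assumes "convex E" and "face_via TYPE('b::real_vector) F E"
  shows "convex F"
proof -
  obtain f :: "'a \<Rightarrow> 'b" and L b where "F = E \<inter> f -` {0}" "linear L" "f = (\<lambda>x. L x + b)"
    using assms(2) unfolding face_via_def oriented_affine_map_def affine_map_def by blast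
  then have "F = E \<inter> L -` {- b}"
    by (auto simp: eq_neg_iff_add_eq_0)
  then show ?thesis
    using assms(1) \<open>linear L\<close> by (simp add: convex_Int convex_linear_vimage)
qed

text \<open>Any cone for which all points of \<open>F\<close> are least in \<open>E\<close> must
  contain \<open>E \<ominus> F\<close>, so the cone hull is the smallest candidate. That no further
  point of \<open>E\<close> becomes least follows from the positivity of \<open>f\<close>.\<close>

lemma min_set_cone_hull_face:
  fixes F E :: "'a::real_vector set"
  assumes ne: "F \<noteq> {}" and face: "face_via TYPE('b::real_vector) F E"
  shows "min_set (cone hull (E \<ominus> F)) E = F"
proof -
  obtain f :: "'a \<Rightarrow> 'b" and K L b where K: "convex_cone K" "pointed K" and pos: "f ` E \<subseteq> K"
    and F: "F = E \<inter> f -` {0}" and L: "linear L" "f = (\<lambda>x. L x + b)"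
    using face unfolding face_via_def oriented_affine_map_def affine_map_def by blast
  have diff: "L (x - y) = f x - f y" for x y
    by (simp add: L(2) linear_diff[OF L(1)])
  show ?thesis
  proof (intro equalityI subsetI)
    fix s assume "s \<in> F"
    then have "s' - s \<in> cone hull (E \<ominus> F)" if "s' \<in> E" for s'
      using that by (intro hull_inc) (auto simp: minkowski_diff_iff)
    with \<open>s \<in> F\<close> show "s \<in> min_set (cone hull (E \<ominus> F)) E"
      unfolding min_set_def cone_le_def by (simp add: F)
  next
    fix s assume s: "s \<in> min_set (cone hull (E \<ominus> F)) E"
    obtain s0 where s0: "s0 \<in> F"
      using ne by blast
    have "s0 - s \<in> cone hull (E \<ominus> F)"
      using s s0 unfolding min_set_def cone_le_def F by blast
    \<comment> \<open>An element of the cone hull is a single nonnegative multiple, so one pair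
      \<open>e\<close>, \<open>s1\<close> suffices.\<close>
    then obtain t e s1 where t: "t \<ge> 0" "e \<in> E" "s1 \<in> F" "s0 - s = t *\<^sub>R (e - s1)"
      unfolding cone_hull_expl minkowski_diff_iff by blast
    have "f s0 - f s = t *\<^sub>R (f e - f s1)"
      using arg_cong[OF t(4), of L] by (simp only: linear_scale[OF L(1)] diff)
    \<comment> \<open>Both \<open>f s0\<close> and \<open>f s1\<close> vanish, which leaves
      \<open>f s\<close> in \<open>K\<close> and in its negative.\<close>
    then have "f s = - (t *\<^sub>R f e)"
      using s0 t(3) by (simp add: F neg_eq_iff_add_eq_0 eq_neg_iff_add_eq_0)
    moreover have "t *\<^sub>R f e \<in> K"
      using K(1) t(1,2) pos unfolding convex_cone_iff by blast
    moreover have "s \<in> E"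
      using s unfolding min_set_def by blast
    moreover from this have "f s \<in> K"
      using pos by blast
    ultimately show "s \<in> F"
      using K(2) unfolding pointed_def F by blast
  qed
qed

text \<open>The cone hull closes only under nonnegative scaling; it inherits convexity from
  \<open>S\<close>, and \<open>S\<close> being nonempty keeps it nonempty.\<close>

lemma convex_cone_cone_hull:
  assumes "convex S" and "S \<noteq> {}"
  shows "convex_cone (cone hull S)"
  unfolding convex_cone_def conic_def
  using assms convex_cone_hull mem_cone[OF cone_cone_hull] cone_hull_empty_iff by blast

theorem theorem6p1:
  fixes C D F :: "'a::real_vector set"
  assumes "convex C" and "convex D"
    and "F \<noteq> {}"
    and "face_via TYPE('b::real_vector) F (C \<ominus> D)"
  shows "(\<forall>P. convex_cone P \<and> F = min_set P (C \<ominus> D) \<longrightarrow>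
            face_via TYPE('a \<times> real) (min_set P C) C \<and>
            face_via TYPE('a \<times> real) (max_set P D) D \<and>
            F = min_set P C \<ominus> max_set P D) \<and>
         (\<exists>P. convex_cone P \<and> F = min_set P (C \<ominus> D)) \<and>
         convex_cone (cone hull ((C \<ominus> D) \<ominus> F)) \<and>
         F = min_set (cone hull ((C \<ominus> D) \<ominus> F)) (C \<ominus> D)"
proof -
  let ?E = "C \<ominus> D"
  have "convex ?E"
    using assms(1,2) by (rule convex_minkowski_diff)
  then have "convex (?E \<ominus> F)"
    using convex_face_via[OF _ assms(4)] by (simp add: convex_minkowski_diff)
  \<comment> \<open>A face is a subset of \<open>?E\<close>, so any point of \<open>F\<close> can be
    subtracted from itself.\<close>
  moreover have "?E \<ominus> F \<noteq> {}"
    using assms(3,4) unfolding face_via_def minkowski_diff_def[of ?E F] by blast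
  ultimately have cone: "convex_cone (cone hull (?E \<ominus> F))"
    by (rule convex_cone_cone_hull)
  have least: "F = min_set (cone hull (?E \<ominus> F)) ?E"
    using min_set_cone_hull_face[OF assms(3,4)] by (rule sym)
  have "face_via TYPE('a \<times> real) (min_set P C) C \<and>
      face_via TYPE('a \<times> real) (max_set P D) D \<and> F = min_set P C \<ominus> max_set P D"
    if P: "convex_cone P" and F: "F = min_set P ?E" for P
  proof -
    have eq: "F = min_set P C \<ominus> max_set P D"
      using min_set_minkowski_diff[OF P] assms(3) F by simp
    \<comment> \<open>A nonempty difference has nonempty operands, which supplies the base points
      for the face maps.\<close>
    then have "min_set P C \<noteq> {}" "max_set P D \<noteq> {}"
      using assms(3) unfolding minkowski_diff_def by auto
    then have "face_via TYPE('a) (min_set P C) C" "face_via TYPE('a) (max_set P D) D"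
      using face_via_min_set P convex_cone_uminus unfolding max_set_eq_min_set_uminus by blast+
    \<comment> \<open>The faces were exhibited by maps into \<open>'a\<close>;
      \<open>face_via_universal\<close> transfers them to the target of the statement.\<close>
    with eq show ?thesis
      by (blast intro: face_via_universal)
  qed
  with cone least show ?thesis
    by blast
qed

end
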